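(* Let $G=(V,E)$ be a simple undirected connected graph with $n=|V|$ vertices. For each $i\in[0,n]$ define $\Delta(i)=\max\{\mathrm{e}(S): S\subseteq V, |S|=i\}$, $\Sigma(i)=\min\{\mathrm{e}(S): S\subseteq V, |S|=i\}$, $\mathrm{T}(i)=\max\{\mathrm{vc}(S): S\subseteq V, |S|=i\}$, $\Upsilon(i)=\min\{\mathrm{vc}(S): S\subseteq V, |S|=i\}$, where for $S\subseteq V$, $\mathrm{e}(S)$ is the number of edges $uv\in E$ with both $u\in S$ and $v\in S$, and $\mathrm{vc}(S)$ is the number of edges $uv\in E$ with $u\in S$ or $v\in S$. For each $i\in[1,n]$ define $\delta(i)=\Delta(i)-\Delta(i-1)$, $\sigma(i)=\Sigma(i)-\Sigma(i-1)$, $\tau(i)=\mathrm{T}(i)-\mathrm{T}(i-1)$, $\upsilon(i)=\Upsilon(i)-\Upsilon(i-1)$. Call a sequence $s(1),\dots,s(n)$ symmetric if $s(i)+s(n-i+1)=s(1)+s(n)$ for every $i\in[1,n]$. Then for each $s\in\{\delta,\sigma,\tau,\upsilon\}$: $G$ is regular (all vertices have the same degree) if and only if the sequence $s(1),\dots,s(n)$ is symmetric.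
   Context: $[a,b]$ denotes the set of integers $\{a,a+1,\dots,b\}$. Graphs are simple, undirected, connected and finite. *)

theory Defs
  imports Main
begin

locale finite_simple_graph =
  fixes V :: "'a set" and E :: "'a set set"
  assumes finite_verts: "finite V"
    and edges_wf: "e \<in> E \<Longrightarrow> e \<subseteq> V \<and> card e = 2"

text \<open>The graph without vertices counts as connected here; the usual convention excludes it.\<close>

locale connected_simple_graph = finite_simple_graph V E
  for V :: "'a set" and E :: "'a set set" +
  assumes connected: "u \<in> V \<Longrightarrow> v \<in> V \<Longrightarrow> (u, v) \<in> {(x, y). {x, y} \<in> E}\<^sup>*"

definition degree :: "'a set set \<Rightarrow> 'a \<Rightarrow> nat" where
  "degree E v = card {e \<in> E. v \<in> e}"

definition regular :: "'a set \<Rightarrow> 'a set set \<Rightarrow> bool" where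
  "regular V E \<longleftrightarrow> (\<forall>u\<in>V. \<forall>v\<in>V. degree E u = degree E v)"

definition induced_edges :: "'a set set \<Rightarrow> 'a set \<Rightarrow> nat" where
  "induced_edges E S = card {e \<in> E. e \<subseteq> S}"

definition covered_edges :: "'a set set \<Rightarrow> 'a set \<Rightarrow> nat" where
  "covered_edges E S = card {e \<in> E. e \<inter> S \<noteq> {}}"

definition max_induced :: "'a set \<Rightarrow> 'a set set \<Rightarrow> nat \<Rightarrow> nat" where
  "max_induced V E i = Max (induced_edges E ` {S. S \<subseteq> V \<and> card S = i})"

definition min_induced :: "'a set \<Rightarrow> 'a set set \<Rightarrow> nat \<Rightarrow> nat" where
  "min_induced V E i = Min (induced_edges E ` {S. S \<subseteq> V \<and> card S = i})"

definition max_covered :: "'a set \<Rightarrow> 'a set set \<Rightarrow> nat \<Rightarrow> nat" where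
  "max_covered V E i = Max (covered_edges E ` {S. S \<subseteq> V \<and> card S = i})"

definition min_covered :: "'a set \<Rightarrow> 'a set set \<Rightarrow> nat \<Rightarrow> nat" where
  "min_covered V E i = Min (covered_edges E ` {S. S \<subseteq> V \<and> card S = i})"

text \<open>The four difference sequences are only meaningful at indices \<open>1, \<dots>, card V\<close>:
  at \<open>0\<close> the subtraction \<open>i - 1\<close> truncates, and beyond \<open>card V\<close> the maximum or
  minimum is taken over the empty set.\<close>

definition delta_seq :: "'a set \<Rightarrow> 'a set set \<Rightarrow> nat \<Rightarrow> int" where
  "delta_seq V E i = int (max_induced V E i) - int (max_induced V E (i - 1))"

definition sigma_seq :: "'a set \<Rightarrow> 'a set set \<Rightarrow> nat \<Rightarrow> int" where
  "sigma_seq V E i = int (min_induced V E i) - int (min_induced V E (i - 1))"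

definition tau_seq :: "'a set \<Rightarrow> 'a set set \<Rightarrow> nat \<Rightarrow> int" where
  "tau_seq V E i = int (max_covered V E i) - int (max_covered V E (i - 1))"

definition upsilon_seq :: "'a set \<Rightarrow> 'a set set \<Rightarrow> nat \<Rightarrow> int" where
  "upsilon_seq V E i = int (min_covered V E i) - int (min_covered V E (i - 1))"

definition symmetric_seq :: "nat \<Rightarrow> (nat \<Rightarrow> int) \<Rightarrow> bool" where
  "symmetric_seq n s \<longleftrightarrow> (\<forall>i\<in>{1..n}. s i + s (n - i + 1) = s 1 + s n)"

end

(* Write F for the extremal (maximal or minimal) number of induced edges. Passing to complements
   turns the covered-edge sequences into the induced-edge sequences read backwards, so it suffices
   to treat F. In a d-regular graph e(V - S) = |E| - d |S| + e(S), hence F(n - i) = |E| - d i + F(i),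
   and taking differences gives symmetry with constant d. Conversely, s(1) = 0 and s(n) is an
   extremal degree d0; summing the symmetry relation over all i gives 2 |E| = n d0, so by the
   handshake lemma the average degree is extremal and all degrees coincide. *)

theory Submission
  imports Defs
begin

section \<open>Reversing finite sequences\<close>

lemma sum_rev_pair:
  fixes f :: "nat \<Rightarrow> int"
  assumes "\<forall>i\<in>{1..n}. f i + f (n - i + 1) = c"
  shows "2 * (\<Sum>i=1..n. f i) = int n * c"
proof -
  \<comment> \<open>The map \<open>i\<close> to \<open>n - i + 1\<close> is an involution of
    \<open>{1..n}\<close>, so the sum can be read backwards; adding both readings puts each
    symmetric pair into one term.\<close>
  have "(\<Sum>i=1..n. f i) = (\<Sum>i=1..n. f (n - i + 1))"
    by (rule sum.reindex_bij_witness[of _ "\<lambda>i. n - i + 1" "\<lambda>i. n - i + 1"]) auto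
  then have "2 * (\<Sum>i=1..n. f i) = (\<Sum>i=1..n. f i + f (n - i + 1))"
    by (simp add: sum.distrib)
  also have "\<dots> = (\<Sum>i=1..n. c)"
    using assms by (intro sum.cong) auto
  finally show ?thesis
    by simp
qed

text \<open>Reversal only swaps the two summands on each side of the symmetry relation, so each
  index gives the same equation for \<open>t\<close> as for \<open>s\<close>.\<close>

lemma symmetric_seq_rev:
  assumes "\<And>i. i \<in> {1..n} \<Longrightarrow> t i = s (n - i + 1)"
  shows "symmetric_seq n t \<longleftrightarrow> symmetric_seq n s"
proof -
  have "t i + t (n - i + 1) = t 1 + t n \<longleftrightarrow> s i + s (n - i + 1) = s 1 + s n"
    if "i \<in> {1..n}" for i
    using that assms[of i] assms[of "n - i + 1"] assms[of 1] assms[of n]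
    by (auto simp: algebra_simps)
  then show ?thesis
    unfolding symmetric_seq_def by auto
qed

section \<open>Layers, complements and edge counts\<close>

context finite_simple_graph
begin

definition layer :: "nat \<Rightarrow> 'a set set" where
  "layer i = {S. S \<subseteq> V \<and> card S = i}"

text \<open>The parameter \<open>opt\<close> stands for \<open>Max\<close> or \<open>Min\<close>, so
  that one argument serves both the delta and the sigma sequence.\<close>

definition extremal_induced :: "(nat set \<Rightarrow> nat) \<Rightarrow> nat \<Rightarrow> nat" where
  "extremal_induced opt i = opt (induced_edges E ` layer i)"

lemma finite_edges: "finite E"
  using finite_verts edges_wf by (auto intro: finite_subset[of E "Pow V"])

lemma finite_layer: "finite (layer i)"
  using finite_verts by (auto simp: layer_def)

lemma layer_nonempty: "i \<le> card V \<Longrightarrow> layer i \<noteq> {}"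
  using obtain_subset_with_card_n[of i V] by (auto simp: layer_def)

lemma complement_layer:
  assumes "i \<le> card V"
  shows "(\<lambda>S. V - S) ` layer i = layer (card V - i)"
proof
  show "(\<lambda>S. V - S) ` layer i \<subseteq> layer (card V - i)"
    using finite_verts by (auto simp: layer_def card_Diff_subset finite_subset)
  show "layer (card V - i) \<subseteq> (\<lambda>S. V - S) ` layer i"
  proof
    fix S assume "S \<in> layer (card V - i)"
    then have "V - S \<in> layer i" and "S = V - (V - S)"
      using finite_verts assms by (auto simp: layer_def card_Diff_subset finite_subset)
    then show "S \<in> (\<lambda>S. V - S) ` layer i"
      by blast
  qed
qed

text \<open>Since edges lie in \<open>V\<close>, an edge either avoids \<open>S\<close>, and then
  lies in \<open>V - S\<close>, or meets \<open>S\<close>. The additive form avoids truncated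
  subtraction.\<close>

lemma induced_edges_complement:
  "induced_edges E (V - S) + covered_edges E S = card E"
proof -
  have "{e \<in> E. e \<subseteq> V - S} \<union> {e \<in> E. e \<inter> S \<noteq> {}} = E"
    using edges_wf by auto
  moreover have "{e \<in> E. e \<subseteq> V - S} \<inter> {e \<in> E. e \<inter> S \<noteq> {}} = {}"
    by auto
  ultimately show ?thesis
    unfolding induced_edges_def covered_edges_def
    using card_Un_disjoint[of "{e \<in> E. e \<subseteq> V - S}" "{e \<in> E. e \<inter> S \<noteq> {}}"] finite_edges
    by simp
qed

text \<open>Double counting of the pairs of a vertex in \<open>S\<close> and an edge through
  it.\<close>

lemma sum_degree:
  assumes "S \<subseteq> V"
  shows "(\<Sum>v\<in>S. degree E v) = covered_edges E S + induced_edges E S"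
proof -
  have fin: "finite S"
    using assms finite_verts finite_subset by blast
  \<comment> \<open>An edge counts once for meeting \<open>S\<close> and once more if its second
    endpoint is in \<open>S\<close> too.\<close>
  have card_Int_edge: "card {v \<in> S. v \<in> e} = of_bool (e \<inter> S \<noteq> {}) + of_bool (e \<subseteq> S)"
    if e: "e \<in> E" for e
  proof -
    obtain a b where "e = {a, b}" "a \<noteq> b"
      using edges_wf[OF e] by (auto simp: card_2_iff)
    moreover have "{v \<in> S. v = a \<or> v = b} = (if a \<in> S then {a} else {}) \<union> (if b \<in> S then {b} else {})"
      by auto
    ultimately show ?thesis
      by auto
  qed
  have "(\<Sum>v\<in>S. degree E v) = (\<Sum>v\<in>S. \<Sum>e\<in>E. of_bool (v \<in> e))"
    unfolding degree_def using finite_edges by (simp add: sum.If_cases Int_def)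
  also have "\<dots> = (\<Sum>e\<in>E. card {v \<in> S. v \<in> e})"
    using fin by (subst sum.swap) (simp add: sum.If_cases Int_def)
  also have "\<dots> = (\<Sum>e\<in>E. of_bool (e \<inter> S \<noteq> {}) + of_bool (e \<subseteq> S))"
    using card_Int_edge by (intro sum.cong) auto
  also have "\<dots> = covered_edges E S + induced_edges E S"
    unfolding covered_edges_def induced_edges_def using finite_edges
    by (simp add: sum.distrib Int_def)
  finally show ?thesis .
qed

lemma induced_edges_V: "induced_edges E V = card E"
  unfolding induced_edges_def using edges_wf by (metis (no_types, lifting) Collect_cong Collect_mem_eq)

lemma induced_edges_small:
  assumes "S \<subseteq> V" "card S \<le> 1"
  shows "induced_edges E S = 0"
proof -
  have "\<not> e \<subseteq> S" if "e \<in> E" for e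
    using card_mono[of S e] edges_wf[OF that] assms finite_verts finite_subset by fastforce
  then have "{e \<in> E. e \<subseteq> S} = {}"
    by blast
  then show ?thesis
    by (simp only: induced_edges_def card.empty)
qed

lemma handshake: "(\<Sum>v\<in>V. degree E v) = 2 * card E"
  using sum_degree[of V] induced_edges_complement[of V] induced_edges_V induced_edges_small[of "{}"]
  by simp

section \<open>Extremal numbers of induced edges\<close>

lemma extremal_induced_cases:
  assumes "opt \<in> {Max, Min}" "i \<le> card V"
  obtains S where "S \<in> layer i" "extremal_induced opt i = induced_edges E S"
proof -
  have "opt (induced_edges E ` layer i) \<in> induced_edges E ` layer i"
    using assms finite_layer layer_nonempty by auto
  then show ?thesis
    using that by (auto simp: extremal_induced_def)
qed

lemma extremal_induced_small:
  assumes "opt \<in> {Max, Min}" "i \<le> card V" "i \<le> 1"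
  shows "extremal_induced opt i = 0"
  using extremal_induced_cases[OF assms(1,2)] induced_edges_small assms(3)
  by (metis (mono_tags, lifting) layer_def mem_Collect_eq)

lemma extremal_induced_card:
  assumes "opt \<in> {Max, Min}"
  shows "extremal_induced opt (card V) = card E"
proof -
  obtain S where "S \<in> layer (card V)" "extremal_induced opt (card V) = induced_edges E S"
    using extremal_induced_cases[OF assms] by blast
  then show ?thesis
    using card_subset_eq[OF finite_verts] induced_edges_V by (auto simp: layer_def)
qed

text \<open>When all degrees are \<open>d\<close>, \<open>sum_degree\<close> and
  \<open>induced_edges_complement\<close> give the same relation for every single \<open>S\<close>
  in the layer. Its two counts differ by a constant depending only on \<open>i\<close>, so it
  survives taking the optimum.\<close>

lemma extremal_induced_complement:
  assumes "opt \<in> {Max, Min}" "i \<le> card V" "\<And>v. v \<in> V \<Longrightarrow> degree E v = d"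
  shows "extremal_induced opt (card V - i) + d * i = extremal_induced opt i + card E"
proof -
  have "induced_edges E (V - S) + d * i = induced_edges E S + card E" if "S \<in> layer i" for S
  proof -
    have "(\<Sum>v\<in>S. degree E v) = (\<Sum>v\<in>S. d)"
      using assms(3) that by (intro sum.cong) (auto simp: layer_def)
    then show ?thesis
      using sum_degree[of S] induced_edges_complement[of S] that by (auto simp: layer_def algebra_simps)
  qed
  then have "opt ((\<lambda>S. induced_edges E (V - S) + d * i) ` layer i)
      = opt ((\<lambda>S. induced_edges E S + card E) ` layer i)"
    by (metis (mono_tags, lifting) image_cong)
  \<comment> \<open>Adding a constant commutes with \<open>Max\<close> and \<open>Min\<close>
    because the layer is finite and nonempty.\<close>
  moreover have "opt ((\<lambda>S. f S + k) ` layer i) = opt (f ` layer i) + k" for f and k :: nat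
    using assms(1) Max_add_commute[OF finite_layer layer_nonempty[OF assms(2)]]
      Min_add_commute[OF finite_layer layer_nonempty[OF assms(2)]] by auto
  ultimately have "opt ((\<lambda>S. induced_edges E (V - S)) ` layer i) + d * i
      = opt (induced_edges E ` layer i) + card E"
    by simp
  then show ?thesis
    by (simp add: extremal_induced_def complement_layer[OF assms(2), symmetric] image_image)
qed

text \<open>A set of size \<open>card V - 1\<close> omits one vertex and loses exactly the edges at
  it. Hence \<open>Max\<close> selects a vertex of least degree and \<open>Min\<close> one of
  greatest degree; the disjunction leaves open which, as either suffices to compare with the
  average.\<close>

lemma extremal_induced_penultimate:
  assumes "opt \<in> {Max, Min}" "V \<noteq> {}"
  obtains v where "v \<in> V" "extremal_induced opt (card V - 1) + degree E v = card E"
    "(\<forall>u\<in>V. degree E v \<le> degree E u) \<or> (\<forall>u\<in>V. degree E u \<le> degree E v)"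
proof -
  have V1: "1 \<le> card V"
    using assms(2) finite_verts by (simp add: Suc_le_eq card_gt_0_iff)
  have "layer 1 = (\<lambda>v. {v}) ` V"
    by (auto simp: layer_def card_1_singleton_iff)
  then have layer: "layer (card V - 1) = (\<lambda>v. V - {v}) ` V"
    using complement_layer[OF V1] by (simp add: image_image)
  have deg: "induced_edges E (V - {v}) + degree E v = card E" for v
    using induced_edges_complement[of "{v}"] by (simp add: covered_edges_def degree_def)
  have degree_le: "degree E u \<le> degree E v
      \<longleftrightarrow> induced_edges E (V - {v}) \<le> induced_edges E (V - {u})" for u v
    using deg[of u] deg[of v] by linarith
  obtain v where v: "v \<in> V" "extremal_induced opt (card V - 1) = induced_edges E (V - {v})"
    by (rule extremal_induced_cases[OF assms(1), of "card V - 1"]) (use layer in auto)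
  have mem: "induced_edges E (V - {u}) \<in> induced_edges E ` layer (card V - 1)" if "u \<in> V" for u
    using layer that by auto
  have fin: "finite (induced_edges E ` layer (card V - 1))"
    using finite_layer by auto
  have "(\<forall>u\<in>V. induced_edges E (V - {u}) \<le> induced_edges E (V - {v}))
      \<or> (\<forall>u\<in>V. induced_edges E (V - {v}) \<le> induced_edges E (V - {u}))"
    using assms(1) Max_ge[OF fin mem] Min_le[OF fin mem] v(2)
    by (auto simp: extremal_induced_def)
  then have "(\<forall>u\<in>V. degree E v \<le> degree E u) \<or> (\<forall>u\<in>V. degree E u \<le> degree E v)"
    by (auto simp: degree_le)
  then show ?thesis
    using that v deg by auto
qed

section \<open>Regularity and symmetry for induced edges\<close>

lemma regular_iff_symmetric_extremal_induced:
  assumes opt: "opt \<in> {Max, Min}"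
    and s: "\<And>i. s i = int (extremal_induced opt i) - int (extremal_induced opt (i - 1))"
  shows "regular V E \<longleftrightarrow> symmetric_seq (card V) s"
\<comment> \<open>Without vertices there is no vertex of extremal degree to choose, but both sides
  hold vacuously.\<close>
proof (cases "V = {}")
  case True
  then show ?thesis
    by (simp add: regular_def symmetric_seq_def)
next
  case False
  then have V1: "1 \<le> card V"
    using finite_verts by (simp add: Suc_le_eq card_gt_0_iff)
  show ?thesis
  proof
    assume "regular V E"
    then obtain d where d: "\<And>v. v \<in> V \<Longrightarrow> degree E v = d"
      using False by (metis ex_in_conv regular_def)
    have "s i + s (card V - i + 1) = int d" if i: "i \<in> {1..card V}" for i
    proof -
      have "card V - (i - 1) = card V - i + 1"
        using i by auto
      moreover
      have "int (extremal_induced opt (card V - j)) + int d * int j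
          = int (extremal_induced opt j) + int (card E)" if "j \<le> card V" for j
        using extremal_induced_complement[OF opt that d] by (metis of_nat_add of_nat_mult)
      \<comment> \<open>The difference of these two instances is the relation
        \<open>s i + s (card V - i + 1) = d\<close>.\<close>
      from this[of i] this[of "i - 1"] i
      have "int (extremal_induced opt (card V - i)) + int d * int i
          = int (extremal_induced opt i) + int (card E)"
        and "int (extremal_induced opt (card V - (i - 1))) + int d * int i
          = int (extremal_induced opt (i - 1)) + int (card E) + int d"
        by (auto simp: of_nat_diff algebra_simps)
      ultimately show ?thesis
        by (simp add: s)
    qed
    moreover from this[of 1] have "s 1 + s (card V) = int d"
      using V1 by simp
    ultimately show "symmetric_seq (card V) s"
      by (simp add: symmetric_seq_def)
  next
    assume sym: "symmetric_seq (card V) s"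
    obtain v where v: "extremal_induced opt (card V - 1) + degree E v = card E"
      "(\<forall>u\<in>V. degree E v \<le> degree E u) \<or> (\<forall>u\<in>V. degree E u \<le> degree E v)"
      using extremal_induced_penultimate[OF opt False] by blast
    \<comment> \<open>Sets of size 0 or 1 induce no edge, so \<open>s 1\<close> vanishes, and
      \<open>s (card V)\<close> is the number of edges lost with \<open>v\<close>.\<close>
    have "s 1 + s (card V) = int (degree E v)"
      using v(1) extremal_induced_small[OF opt] extremal_induced_card[OF opt] V1
      by (simp add: s)
    then have "2 * (\<Sum>i=1..card V. s i) = int (card V) * int (degree E v)"
      using sum_rev_pair[of "card V" s] sym by (simp add: symmetric_seq_def)
    \<comment> \<open>The sum of differences telescopes; up to \<open>card V\<close> it equals
      \<open>card E\<close>.\<close>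
    moreover have "(\<Sum>i=1..m. s i) = int (extremal_induced opt m) - int (extremal_induced opt 0)" for m
      by (induction m) (auto simp: s)
    ultimately have "2 * int (card E) = int (card V) * int (degree E v)"
      using extremal_induced_small[OF opt] extremal_induced_card[OF opt] by simp
    then have "2 * card E = card V * degree E v"
      by (metis of_nat_eq_iff of_nat_mult of_nat_numeral)
    \<comment> \<open>The degrees have the same sum as the constant \<open>degree E v\<close>, which
      bounds them all from one side, so each inequality is an equality.\<close>
    then have sum: "(\<Sum>u\<in>V. degree E u) = (\<Sum>u\<in>V. degree E v)"
      using handshake by simp
    have "degree E u = degree E v" if "u \<in> V" for u
      using v(2)
    proof
      assume "\<forall>u\<in>V. degree E v \<le> degree E u"
      then show ?thesis
        using sum_mono_inv[OF sum[symmetric] _ that finite_verts] by auto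
    next
      assume "\<forall>u\<in>V. degree E u \<le> degree E v"
      then show ?thesis
        using sum_mono_inv[OF sum _ that finite_verts] by auto
    qed
    then show "regular V E"
      by (simp add: regular_def)
  qed
qed

lemma regular_iff_symmetric_delta: "regular V E \<longleftrightarrow> symmetric_seq (card V) (delta_seq V E)"
  by (rule regular_iff_symmetric_extremal_induced[of Max])
    (auto simp: delta_seq_def max_induced_def extremal_induced_def layer_def)

lemma regular_iff_symmetric_sigma: "regular V E \<longleftrightarrow> symmetric_seq (card V) (sigma_seq V E)"
  by (rule regular_iff_symmetric_extremal_induced[of Min])
    (auto simp: sigma_seq_def min_induced_def extremal_induced_def layer_def)

section \<open>Covered edges through complements\<close>

lemma covered_edges_image_layer:
  assumes "i \<le> card V"
  shows "covered_edges E ` {S. S \<subseteq> V \<and> card S = i}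
    = (\<lambda>k. card E - k) ` induced_edges E ` {S. S \<subseteq> V \<and> card S = card V - i}"
proof -
  have "covered_edges E S = card E - induced_edges E (V - S)" for S
    using induced_edges_complement[of S] by simp
  then have "covered_edges E ` layer i
      = (\<lambda>k. card E - k) ` induced_edges E ` (\<lambda>S. V - S) ` layer i"
    by (simp add: image_image)
  then show ?thesis
    unfolding complement_layer[OF assms] by (simp only: layer_def)
qed

text \<open>The map \<open>k\<close> to \<open>card E - k\<close> reverses the order, so maxima of
  covered edges come from minima of induced edges on complements, and vice versa.\<close>

lemma covered_extremal:
  assumes "i \<le> card V"
  shows max_covered_eq: "int (max_covered V E i) = int (card E) - int (min_induced V E (card V - i))"
    and min_covered_eq: "int (min_covered V E i) = int (card E) - int (max_induced V E (card V - i))"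
proof -
  let ?A = "induced_edges E ` {S. S \<subseteq> V \<and> card S = card V - i}"
  have A: "finite ?A" "?A \<noteq> {}"
    using finite_layer[of "card V - i"] layer_nonempty[of "card V - i"] by (auto simp: layer_def)
  \<comment> \<open>This bound makes the subtraction on naturals exact when it is transferred to the
    integers.\<close>
  have le: "k \<le> card E" if "k \<in> ?A" for k
    using that finite_edges by (auto simp: induced_edges_def intro: card_mono)
  have "Max ((\<lambda>k. card E - k) ` ?A) = card E - Min ?A"
    using A by (intro Max_eqI) (auto intro!: diff_le_mono2 Min_le)
  then show "int (max_covered V E i) = int (card E) - int (min_induced V E (card V - i))"
    using le[OF Min_in[OF A]]
    by (simp add: max_covered_def min_induced_def covered_edges_image_layer[OF assms] of_nat_diff)
  have "Min ((\<lambda>k. card E - k) ` ?A) = card E - Max ?A"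
    using A by (intro Min_eqI) (auto intro!: diff_le_mono2 Max_ge)
  then show "int (min_covered V E i) = int (card E) - int (max_induced V E (card V - i))"
    using le[OF Max_in[OF A]]
    by (simp add: min_covered_def max_induced_def covered_edges_image_layer[OF assms] of_nat_diff)
qed

text \<open>In the difference of \<open>max_covered_eq\<close> at \<open>i\<close> and
  \<open>i - 1\<close> the term \<open>card E\<close> cancels, and the two signs combine to a
  forward difference at the reflected index.\<close>

lemma tau_seq_eq_sigma_seq:
  assumes "i \<in> {1..card V}"
  shows "tau_seq V E i = sigma_seq V E (card V - i + 1)"
proof -
  have "card V - (i - 1) = card V - i + 1"
    using assms by auto
  then show ?thesis
    using assms max_covered_eq[of i] max_covered_eq[of "i - 1"]
    by (simp add: tau_seq_def sigma_seq_def)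
qed

lemma upsilon_seq_eq_delta_seq:
  assumes "i \<in> {1..card V}"
  shows "upsilon_seq V E i = delta_seq V E (card V - i + 1)"
proof -
  have "card V - (i - 1) = card V - i + 1"
    using assms by auto
  then show ?thesis
    using assms min_covered_eq[of i] min_covered_eq[of "i - 1"]
    by (simp add: upsilon_seq_def delta_seq_def)
qed

end

theorem theorem1:
  fixes V :: "'a set" and E :: "'a set set" and s :: "nat \<Rightarrow> int"
  assumes "connected_simple_graph V E"
    and "s \<in> {delta_seq V E, sigma_seq V E, tau_seq V E, upsilon_seq V E}"
  shows "regular V E \<longleftrightarrow> symmetric_seq (card V) s"
proof -
  interpret connected_simple_graph V E
    by fact
  have "symmetric_seq (card V) (tau_seq V E) \<longleftrightarrow> symmetric_seq (card V) (sigma_seq V E)"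
    by (rule symmetric_seq_rev) (rule tau_seq_eq_sigma_seq)
  moreover have "symmetric_seq (card V) (upsilon_seq V E) \<longleftrightarrow> symmetric_seq (card V) (delta_seq V E)"
    by (rule symmetric_seq_rev) (rule upsilon_seq_eq_delta_seq)
  ultimately show ?thesis
    using assms(2) regular_iff_symmetric_delta regular_iff_symmetric_sigma by auto
qed

end
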